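(* Let $n\ge 2$ be an integer and let $F_n=\{x^n+y^n=z^n\}\subset\mathbb{C}P^2$ be the Fermat curve. Then the curve projectively dual to it, in $(\mathbb{C}P^2)^\ast$ with dual coordinates $u,v,w$, is defined by the equation $F_n^\vee(u,v,w)=0$, where $$F_n^\vee(u,v,w)=p_{n-1}(w^n;u^n,v^n).$$
   Context: For an integer $k\ge1$ and $\varepsilon$ a primitive $k$-th root of unity, $p_k(z;x,y)=\prod_{r,s=1}^{k}\bigl(\sqrt[k]{z}+\varepsilon^r\sqrt[k]{x}+\varepsilon^s\sqrt[k]{y}\bigr)$, where a fixed branch of the $k$-th root is chosen; this is a symmetric polynomial in $x,y,z$ with integer coefficients. The projectively dual curve of a curve $X\subset\mathbb{C}P^2$ is the closure in the dual plane $(\mathbb{C}P^2)^\ast$ of the set of lines tangent to $X$ at its smooth points; $u,v,w$ are the coordinates on $(\mathbb{C}P^2)^\ast$ dual to $x,y,z$ respectively.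
   Formalization: The sign of w^n is corrected: the dual curve is p_{n-1}(-w^n; u^n, v^n) = 0. With +w^n the formula fails for every n ≥ 2, e.g. at the tangent line (1,0,-1) at [1:0:1]; for n = 2 it gives u²+v²+w² = 0 instead of u²+v² = w². *)

theory Defs
  imports "HOL-Analysis.Analysis"
begin

section \<open>The complex projective plane\<close>

definition proj_rel :: "complex^3 \<Rightarrow> complex^3 \<Rightarrow> bool" where
  "proj_rel v w \<longleftrightarrow> v \<noteq> 0 \<and> w \<noteq> 0 \<and> (\<exists>c. c \<noteq> 0 \<and> w = c *s v)"

lemma proj_rel_part_equivp: "part_equivp proj_rel"
proof (rule part_equivpI)
  have "proj_rel 1 1"
    unfolding proj_rel_def by (metis vector_smult_lid zero_neq_one)
  then show "\<exists>x. proj_rel x x" by blast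
  show "symp proj_rel"
  proof (rule sympI)
    fix v w assume "proj_rel v w"
    then obtain c where "v \<noteq> 0" "w \<noteq> 0" "c \<noteq> 0" "w = c *s v"
      unfolding proj_rel_def by blast
    moreover from this have "v = inverse c *s w" by (simp add: vector_smult_assoc)
    ultimately show "proj_rel w v"
      unfolding proj_rel_def by (metis nonzero_imp_inverse_nonzero)
  qed
  show "transp proj_rel"
  proof (rule transpI)
    fix u v w assume "proj_rel u v" "proj_rel v w"
    then show "proj_rel u w"
      unfolding proj_rel_def by (metis mult_eq_0_iff vector_smult_assoc)
  qed
qed

text \<open>The quotient of the nonzero vectors only; the class of the zero vector is a junk value,
  so every use of the projection below is guarded by nonvanishing.\<close>

quotient_type cp2 = "complex^3" / partial: proj_rel
  morphisms rep_cp2 proj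
  by (rule proj_rel_part_equivp)

text \<open>The quotient topology; the set of nonzero vectors is open, so openness of the preimage may be
  tested in the whole vector space.\<close>

instantiation cp2 :: topological_space
begin

definition open_cp2 :: "cp2 set \<Rightarrow> bool" where
  "open_cp2 U \<longleftrightarrow> open {v. v \<noteq> 0 \<and> proj v \<in> U}"

instance
proof
  have "{v :: complex^3. v \<noteq> 0 \<and> proj v \<in> UNIV} = - {0}" by auto
  then show "open (UNIV :: cp2 set)" by (simp add: open_cp2_def open_Compl)
next
  fix S T :: "cp2 set" assume "open S" "open T"
  then have "open ({v. v \<noteq> 0 \<and> proj v \<in> S} \<inter> {v. v \<noteq> 0 \<and> proj v \<in> T})"
    unfolding open_cp2_def by blast
  moreover have "{v. v \<noteq> 0 \<and> proj v \<in> S} \<inter> {v. v \<noteq> 0 \<and> proj v \<in> T}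
      = {v. v \<noteq> 0 \<and> proj v \<in> S \<inter> T}" by auto
  ultimately show "open (S \<inter> T)" by (simp add: open_cp2_def open_Compl)
next
  fix K :: "cp2 set set" assume "\<forall>S\<in>K. open S"
  then have "open (\<Union>S\<in>K. {v. v \<noteq> 0 \<and> proj v \<in> S})"
    unfolding open_cp2_def by blast
  moreover have "(\<Union>S\<in>K. {v. v \<noteq> 0 \<and> proj v \<in> S}) = {v. v \<noteq> 0 \<and> proj v \<in> \<Union>K}" by auto
  ultimately show "open (\<Union>K)" by (simp add: open_cp2_def open_Compl)
qed

end

definition pt :: "complex \<Rightarrow> complex \<Rightarrow> complex \<Rightarrow> cp2" where
  "pt x y z = proj (vector [x, y, z])"

text \<open>The complex bilinear pairing (the inner product of the library on this type is real).\<close>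

definition pairing :: "complex^3 \<Rightarrow> complex^3 \<Rightarrow> complex" where
  "pairing l v = (\<Sum>i\<in>UNIV. l $ i * v $ i)"

text \<open>The dual plane is identified with \<open>cp2\<close> through the dual coordinates: the point
  \<open>[u : v : w]\<close> stands for the line \<open>u x + v y + w z = 0\<close>.\<close>

definition line :: "cp2 \<Rightarrow> cp2 set" where
  "line l = {proj v | v. v \<noteq> 0 \<and> (\<forall>m. m \<noteq> 0 \<and> proj m = l \<longrightarrow> pairing m v = 0)}"


section \<open>Tangent lines and the projectively dual curve\<close>

definition ternary_form :: "nat \<Rightarrow> (complex^3 \<Rightarrow> complex) \<Rightarrow> bool" where
  "ternary_form d G \<longleftrightarrow>
     (\<exists>a :: nat \<Rightarrow> nat \<Rightarrow> complex. \<forall>v.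
        G v = (\<Sum>i\<le>d. \<Sum>j\<le>d - i. a i j * (v $ 1) ^ i * (v $ 2) ^ j * (v $ 3) ^ (d - i - j)))"

definition gradient :: "(complex^3 \<Rightarrow> complex) \<Rightarrow> complex^3 \<Rightarrow> complex^3" where
  "gradient G v = (\<chi> i. deriv (\<lambda>t. G (v + t *s axis i 1)) 0)"

text \<open>The homogeneous elements of the ideal of \<open>X\<close>.\<close>

definition vanishing_forms :: "cp2 set \<Rightarrow> (complex^3 \<Rightarrow> complex) set" where
  "vanishing_forms X =
     {G. (\<exists>d. ternary_form d G) \<and> (\<forall>v. v \<noteq> 0 \<and> proj v \<in> X \<longrightarrow> G v = 0)}"

text \<open>The embedded (Zariski) tangent space. A point of a curve is smooth iff this space is
  one-dimensional, i.e. a line, which is then the tangent line.\<close>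

definition tangent_space :: "cp2 set \<Rightarrow> cp2 \<Rightarrow> cp2 set" where
  "tangent_space X p =
     {proj w | w. w \<noteq> 0 \<and>
        (\<forall>G\<in>vanishing_forms X. \<forall>v. v \<noteq> 0 \<and> proj v = p \<longrightarrow> pairing (gradient G v) w = 0)}"

definition smooth_point :: "cp2 set \<Rightarrow> cp2 \<Rightarrow> bool" where
  "smooth_point X p \<longleftrightarrow> p \<in> X \<and> (\<exists>l. tangent_space X p = line l)"

definition dual_curve :: "cp2 set \<Rightarrow> cp2 set" where
  "dual_curve X = closure {l. \<exists>p. smooth_point X p \<and> line l = tangent_space X p}"

definition fermat_curve :: "nat \<Rightarrow> cp2 set" where
  "fermat_curve n = {pt x y z | x y z. (x, y, z) \<noteq> (0, 0, 0) \<and> x ^ n + y ^ n = z ^ n}"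


section \<open>The polynomials \<open>p\<^sub>k\<close>\<close>

definition primitive_root_of_unity :: "nat \<Rightarrow> complex \<Rightarrow> bool" where
  "primitive_root_of_unity k \<epsilon> \<longleftrightarrow> \<epsilon> ^ k = 1 \<and> (\<forall>j. 0 < j \<and> j < k \<longrightarrow> \<epsilon> ^ j \<noteq> 1)"

definition root_branch :: "nat \<Rightarrow> (complex \<Rightarrow> complex) \<Rightarrow> bool" where
  "root_branch k rt \<longleftrightarrow> (\<forall>z. rt z ^ k = z)"

text \<open>The value depends neither on the primitive \<open>k\<close>-th root of unity \<open>\<epsilon>\<close> nor on the branch
  \<open>rt\<close> of the \<open>k\<close>-th root; both are kept as parameters.\<close>

definition p_poly ::
  "nat \<Rightarrow> complex \<Rightarrow> (complex \<Rightarrow> complex) \<Rightarrow> complex \<Rightarrow> complex \<Rightarrow> complex \<Rightarrow> complex" where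
  "p_poly k \<epsilon> rt z x y = (\<Prod>r=1..k. \<Prod>s=1..k. rt z + \<epsilon> ^ r * rt x + \<epsilon> ^ s * rt y)"

text \<open>The sign of \<open>w ^ n\<close>: the tangent line at \<open>[x : y : z]\<close> is
  \<open>[x ^ (n - 1) : y ^ (n - 1) : - z ^ (n - 1)]\<close>, so that \<open>u ^ n = (x ^ n) ^ (n - 1)\<close>,
  \<open>v ^ n = (y ^ n) ^ (n - 1)\<close> and \<open>- (w ^ n) = (- (z ^ n)) ^ (n - 1)\<close>, and \<open>x ^ n + y ^ n - z ^ n = 0\<close>
  is the vanishing of one factor of \<open>p\<^sub>n\<^sub>-\<^sub>1\<close> at \<open>(- (w ^ n); u ^ n, v ^ n)\<close>. The formula with
  \<open>+ w ^ n\<close> describes the dual of \<open>x ^ n + y ^ n + z ^ n = 0\<close> and differs from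
  the dual of \<open>x ^ n + y ^ n = z ^ n\<close> for every \<open>n\<close>: for \<open>n = 2\<close> it gives
  \<open>u\<^sup>2 + v\<^sup>2 + w\<^sup>2 = 0\<close> in place of \<open>u\<^sup>2 + v\<^sup>2 = w\<^sup>2\<close>.\<close>

definition fermat_dual ::
  "nat \<Rightarrow> complex \<Rightarrow> (complex \<Rightarrow> complex) \<Rightarrow> complex \<Rightarrow> complex \<Rightarrow> complex \<Rightarrow> complex" where
  "fermat_dual n \<epsilon> rt u v w = p_poly (n - 1) \<epsilon> rt (- (w ^ n)) (u ^ n) (v ^ n)"

end

theory Submission
  imports Defs
begin

text \<open>
  The form \<open>F = x\<^sup>n + y\<^sup>n - z\<^sup>n\<close> has as gradient \<open>n\<close> times
  \<open>\<phi> v = (x\<^sup>m, y\<^sup>m, - z\<^sup>m)\<close>, where \<open>m = n - 1\<close>. This vanishes only at the origin, so every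
  point of the curve is smooth and its tangent line is \<open>\<phi> v\<close>. The dual curve is therefore the
  closure of the image of the curve under \<open>\<phi>\<close>, and three things remain.

  The tangent space is defined by all forms \<open>G\<close> vanishing on the curve, not by \<open>F\<close> alone
  (lemma \<open>tangent_space_fermat_curve\<close>). The two agree because
  every \<open>w\<close> annihilated by \<open>\<phi> v\<close> is the velocity at \<open>v\<close> of a holomorphic curve in the cone
  \<open>F = 0\<close> (lemma \<open>fermat_cone_curve\<close>), and differentiating \<open>G = 0\<close> along it shows that the
  gradient of \<open>G\<close> annihilates \<open>w\<close> too.

  The image under \<open>\<phi>\<close> is already closed. Components of \<open>\<phi> v\<close> grow like powers of those of \<open>v\<close>,
  so \<open>\<phi>\<close> maps closed sets to closed sets (lemma \<open>closed_polar_image\<close>). This is applied to the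
  cone, whose image is invariant under scaling because complex numbers have \<open>m\<close>-th roots.

  The image is cut out by \<open>p\<^sub>m\<close> (lemma \<open>fermat_dual_eq_0_iff\<close>). A factor of
  \<open>p\<^sub>m (- w\<^sup>n; u\<^sup>n, v\<^sup>n)\<close> vanishes iff some \<open>m\<close>-th roots \<open>a, b, c\<close> of the three arguments have sum
  zero. For \<open>(u, v, w) = \<phi> (x, y, z)\<close> these are \<open>- z\<^sup>n, x\<^sup>n, y\<^sup>n\<close>. Conversely
  \<open>b\<^sup>m = u\<^sup>n\<close> with \<open>n = m + 1\<close> lets \<open>x\<close> be chosen with \<open>x\<^sup>m = u\<close> and \<open>x\<^sup>n = b\<close> at the
  same time, namely \<open>x = b / u\<close>; likewise for \<open>y\<close> and \<open>z\<close>, and then \<open>a + b + c = 0\<close> says that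
  \<open>(x, y, z)\<close> lies on the Fermat curve.
\<close>

section \<open>Points and lines of the projective plane\<close>

lemma proj_eq_iff:
  assumes "v \<noteq> 0" "w \<noteq> 0"
  shows "proj v = proj w \<longleftrightarrow> (\<exists>c. c \<noteq> 0 \<and> w = c *s v)"
proof -
  have "proj_rel u u" if "u \<noteq> 0" for u
    using that unfolding proj_rel_def by (metis vector_smult_lid zero_neq_one)
  then have "proj v = proj w \<longleftrightarrow> proj_rel v w"
    using Quotient3_rel[OF Quotient3_cp2, of v w] assms by blast
  then show ?thesis
    using assms by (simp add: proj_rel_def)
qed

lemma proj_surj:
  obtains v where "v \<noteq> 0" "l = proj v"
proof
  show "rep_cp2 l \<noteq> 0"
    using Quotient3_rep_reflp[OF Quotient3_cp2, of l] by (simp add: proj_rel_def)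
  show "l = proj (rep_cp2 l)"
    using Quotient3_abs_rep[OF Quotient3_cp2, of l] by simp
qed

lemma vector_eq_0_iff: "vector [x, y, z] = (0 :: complex^3) \<longleftrightarrow> (x, y, z) = (0, 0, 0)"
  by (simp add: vec_eq_iff forall_3)

lemma vector_components: "vector [v $ 1, v $ 2, v $ 3] = (v :: complex^3)"
  by (simp add: vec_eq_iff forall_3)

lemma pts_eq_projs:
  "{pt x y z | x y z. (x, y, z) \<noteq> (0, 0, 0) \<and> P x y z}
     = {proj v | v. v \<noteq> 0 \<and> P (v $ 1) (v $ 2) (v $ 3)}"
proof (intro equalityI subsetI)
  fix p assume "p \<in> {pt x y z | x y z. (x, y, z) \<noteq> (0, 0, 0) \<and> P x y z}"
  then obtain x y z where "p = proj (vector [x, y, z])" "(x, y, z) \<noteq> (0, 0, 0)" "P x y z"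
    by (auto simp: pt_def)
  then show "p \<in> {proj v | v. v \<noteq> 0 \<and> P (v $ 1) (v $ 2) (v $ 3)}"
    by (auto simp: vector_eq_0_iff intro!: exI[of _ "vector [x, y, z]"])
next
  fix p assume "p \<in> {proj v | v. v \<noteq> 0 \<and> P (v $ 1) (v $ 2) (v $ 3)}"
  then obtain v where "p = proj v" "v \<noteq> 0" "P (v $ 1) (v $ 2) (v $ 3)"
    by auto
  then show "p \<in> {pt x y z | x y z. (x, y, z) \<noteq> (0, 0, 0) \<and> P x y z}"
    unfolding pt_def mem_Collect_eq
    by (metis vector_components vector_eq_0_iff)
qed

lemma pairing_smult_left: "pairing (c *s l) v = c * pairing l v"
  by (simp add: pairing_def sum_distrib_left mult.assoc)

lemma pairing_smult_right: "pairing l (c *s v) = c * pairing l v"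
  by (simp add: pairing_def sum_distrib_left mult.left_commute)

lemma pairing_axis: "pairing l (axis i 1) = l $ i"
  by (simp add: pairing_def axis_def if_distrib cong: if_cong)

lemma line_proj:
  assumes "l \<noteq> 0"
  shows "line (proj l) = {proj v | v. v \<noteq> 0 \<and> pairing l v = 0}"
proof -
  have "(\<forall>m. m \<noteq> 0 \<and> proj m = proj l \<longrightarrow> pairing m v = 0) \<longleftrightarrow> pairing l v = 0" for v
    using assms by (metis mult_eq_0_iff pairing_smult_left proj_eq_iff)
  then show ?thesis
    by (simp add: line_def)
qed

lemma proj_in_line_iff:
  assumes "l \<noteq> 0" "v \<noteq> 0"
  shows "proj v \<in> line (proj l) \<longleftrightarrow> pairing l v = 0"
proof
  assume "proj v \<in> line (proj l)"
  then obtain v' where "v' \<noteq> 0" "proj v' = proj v" "pairing l v' = 0"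
    by (auto simp: line_proj[OF assms(1)])
  then show "pairing l v = 0"
    using assms(2) by (auto simp: proj_eq_iff pairing_smult_right)
next
  assume "pairing l v = 0"
  then show "proj v \<in> line (proj l)"
    using assms by (auto simp: line_proj)
qed

text \<open>If \<open>l $ k \<noteq> 0\<close>, the line of \<open>l\<close> contains the points
  \<open>l\<^sub>k e\<^sub>i - l\<^sub>i e\<^sub>k\<close>, and these already determine \<open>l\<close> up to a factor.\<close>

lemma line_inj:
  assumes "line l = line l'"
  shows "l = l'"
proof -
  obtain a where a: "a \<noteq> 0" "l = proj a" by (rule proj_surj)
  obtain b where b: "b \<noteq> 0" "l' = proj b" by (rule proj_surj)
  have same: "pairing b w = 0" if "pairing a w = 0" for w
  proof (cases "w = 0")
    case False
    then show ?thesis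
      using that assms a b proj_in_line_iff by metis
  qed (simp add: pairing_def)
  obtain k where k: "a $ k \<noteq> 0"
    using a(1) by (auto simp: vec_eq_iff)
  have pair: "pairing m (\<chi> j. a $ k * axis i 1 $ j - a $ i * axis k 1 $ j) = a $ k * m $ i - a $ i * m $ k"
    for m i
  proof -
    have "pairing m (\<chi> j. a $ k * axis i 1 $ j - a $ i * axis k 1 $ j)
        = a $ k * pairing m (axis i 1) - a $ i * pairing m (axis k 1)"
      by (simp add: pairing_def sum_distrib_left sum_subtractf[symmetric] algebra_simps)
    then show ?thesis
      by (simp add: pairing_axis)
  qed
  have "a $ k * b $ i - a $ i * b $ k = 0" for i
    using same[of "\<chi> j. a $ k * axis i 1 $ j - a $ i * axis k 1 $ j"] by (simp add: pair)
  then have "b = (b $ k / a $ k) *s a"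
    using k by (simp add: vec_eq_iff field_simps)
  moreover from this have "b $ k / a $ k \<noteq> 0"
    using b(1) by (metis vector_smult_lzero)
  ultimately show ?thesis
    using a b proj_eq_iff by blast
qed

section \<open>The chain rule for ternary forms\<close>

text \<open>Complex differentiability, tested along curves with complex parameter; this form
  of the chain rule is the only one that the computation of tangent spaces uses.\<close>

definition has_gradient :: "(complex^3 \<Rightarrow> complex) \<Rightarrow> complex^3 \<Rightarrow> complex^3 \<Rightarrow> bool" where
  "has_gradient G g v \<longleftrightarrow>
     (\<forall>\<gamma> w. \<gamma> 0 = v \<and> (\<forall>i. ((\<lambda>t. \<gamma> t $ i) has_field_derivative w $ i) (at 0)) \<longrightarrow>
        ((\<lambda>t. G (\<gamma> t)) has_field_derivative pairing g w) (at 0))"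

lemma has_gradientD:
  assumes "has_gradient G g (\<gamma> 0)"
    and "\<And>i. ((\<lambda>t. \<gamma> t $ i) has_field_derivative w $ i) (at 0)"
  shows "((\<lambda>t. G (\<gamma> t)) has_field_derivative pairing g w) (at 0)"
  using assms unfolding has_gradient_def by blast

lemma has_gradient_const: "has_gradient (\<lambda>v. c) 0 v"
  by (simp add: has_gradient_def pairing_def)

lemma has_gradient_component: "has_gradient (\<lambda>v. v $ i) (axis i 1) v"
proof -
  have "pairing (axis i 1) w = pairing w (axis i 1)" for w
    by (simp add: pairing_def mult.commute)
  then have "pairing (axis i 1) w = w $ i" for w
    by (simp add: pairing_axis)
  then show ?thesis
    by (simp add: has_gradient_def)
qed

lemma has_gradient_add:
  assumes "has_gradient G g v" "has_gradient H h v"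
  shows "has_gradient (\<lambda>v. G v + H v) (g + h) v"
proof -
  have "pairing (g + h) w = pairing g w + pairing h w" for w
    by (simp add: pairing_def sum.distrib ring_distribs)
  then show ?thesis
    using assms unfolding has_gradient_def by (auto intro!: DERIV_add)
qed

lemma has_gradient_mult:
  assumes "has_gradient G g v" "has_gradient H h v"
  shows "has_gradient (\<lambda>v. G v * H v) (H v *s g + G v *s h) v"
proof -
  have "pairing (H v *s g + G v *s h) w = pairing g w * H v + pairing h w * G v" for w
    by (simp add: pairing_def sum_distrib_left sum_distrib_right sum.distrib algebra_simps)
  then show ?thesis
    using assms unfolding has_gradient_def by (auto intro!: DERIV_mult)
qed

lemma has_gradient_power:
  assumes "has_gradient G g v"
  shows "has_gradient (\<lambda>v. G v ^ k) ((of_nat k * G v ^ (k - 1)) *s g) v"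
proof -
  have "((\<lambda>t. G (\<gamma> t) ^ k) has_field_derivative pairing ((of_nat k * G v ^ (k - 1)) *s g) w) (at 0)"
    if "\<gamma> 0 = v" "\<forall>i. ((\<lambda>t. \<gamma> t $ i) has_field_derivative w $ i) (at 0)" for \<gamma> w
  proof -
    have "((\<lambda>t. G (\<gamma> t)) has_field_derivative pairing g w) (at 0)"
      using assms that unfolding has_gradient_def by blast
    from DERIV_power[OF this, of k] show ?thesis
      using that(1) by (simp add: pairing_smult_left mult_ac)
  qed
  then show ?thesis
    by (simp add: has_gradient_def)
qed

lemma has_gradient_sum:
  assumes "\<And>i. i \<in> I \<Longrightarrow> has_gradient (G i) (g i) v"
  shows "has_gradient (\<lambda>v. \<Sum>i\<in>I. G i v) (\<Sum>i\<in>I. g i) v"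
  using assms
  by (induction I rule: infinite_finite_induct) (auto intro!: has_gradient_add has_gradient_const)

lemma has_gradient_imp_gradient:
  assumes "has_gradient G g v"
  shows "gradient G v = g"
proof -
  have "((\<lambda>t. G (v + t *s axis i 1)) has_field_derivative g $ i) (at 0)" for i
  proof -
    have "((\<lambda>t. (v + t *s axis i 1) $ j) has_field_derivative axis i 1 $ j) (at 0)" for j
      by (auto intro!: derivative_eq_intros)
    then show ?thesis
      using has_gradientD[of G g "\<lambda>t. v + t *s axis i 1" "axis i 1"] assms
      by (simp add: pairing_axis)
  qed
  then show ?thesis
    by (simp add: gradient_def vec_eq_iff DERIV_imp_deriv)
qed

lemma ternary_form_has_gradient:
  assumes "ternary_form d G"
  shows "has_gradient G (gradient G v) v"
proof -
  obtain a where G: "G = (\<lambda>v. \<Sum>i\<le>d. \<Sum>j\<le>d - i. a i j * (v $ 1) ^ i * (v $ 2) ^ j * (v $ 3) ^ (d - i - j))"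
    using assms unfolding ternary_form_def by blast
  have "\<exists>g. has_gradient G g v"
    unfolding G
    by (rule exI)
      (rule has_gradient_sum has_gradient_mult has_gradient_power has_gradient_component
        has_gradient_const)+
  then show ?thesis
    using has_gradient_imp_gradient by blast
qed

section \<open>The Fermat form and its polar map\<close>

definition fermat_sign :: "3 \<Rightarrow> complex" where
  "fermat_sign i = (if i = 3 then -1 else 1)"

definition fermat_form :: "nat \<Rightarrow> complex^3 \<Rightarrow> complex" where
  "fermat_form n v = (\<Sum>i\<in>UNIV. fermat_sign i * v $ i ^ n)"

text \<open>The gradient of the Fermat form without its factor \<open>n\<close>: the coordinates of the tangent line.\<close>

definition polar :: "nat \<Rightarrow> complex^3 \<Rightarrow> complex^3" where
  "polar n v = (\<chi> i. fermat_sign i * v $ i ^ (n - 1))"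

lemma fermat_sign_neq_0 [simp]: "fermat_sign i \<noteq> 0"
  and fermat_sign_square [simp]: "fermat_sign i * fermat_sign i = 1"
  by (auto simp: fermat_sign_def)

lemma fermat_sign_simps: "fermat_sign 1 = 1" "fermat_sign 2 = 1" "fermat_sign 3 = -1"
  by (auto simp: fermat_sign_def)

lemma fermat_form_eq: "fermat_form n v = v $ 1 ^ n + v $ 2 ^ n - v $ 3 ^ n"
  by (simp add: fermat_form_def sum_3 fermat_sign_simps)

lemma fermat_form_smult: "fermat_form n (c *s v) = c ^ n * fermat_form n v"
  by (simp add: fermat_form_eq power_mult_distrib algebra_simps)

lemma polar_smult: "polar n (c *s v) = c ^ (n - 1) *s polar n v"
  by (simp add: polar_def vec_eq_iff power_mult_distrib)

lemma polar_eq_0_iff: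
  assumes "n \<ge> 2"
  shows "polar n v = 0 \<longleftrightarrow> v = 0"
  using assms by (simp add: polar_def vec_eq_iff)

lemma proj_in_fermat_curve_iff:
  assumes "v \<noteq> 0"
  shows "proj v \<in> fermat_curve n \<longleftrightarrow> fermat_form n v = 0"
proof -
  have "fermat_curve n = {proj v | v. v \<noteq> 0 \<and> fermat_form n v = 0}"
    unfolding fermat_curve_def by (subst pts_eq_projs) (simp add: fermat_form_eq)
  then show ?thesis
    using assms by (auto simp: proj_eq_iff fermat_form_smult)
qed

text \<open>The coefficient of \<open>z\<^sup>n\<close> belongs to the exponents \<open>i = j = 0\<close>.\<close>

lemma fermat_form_ternary: "ternary_form n (fermat_form n)"
proof -
  define a :: "nat \<Rightarrow> nat \<Rightarrow> complex" where
    "a i j = (if i = n \<and> j = 0 then 1 else 0) + (if i = 0 \<and> j = n then 1 else 0)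
       - (if i = 0 \<and> j = 0 then 1 else 0)" for i j
  have "fermat_form n v
      = (\<Sum>i\<le>n. \<Sum>j\<le>n - i. a i j * (v $ 1) ^ i * (v $ 2) ^ j * (v $ 3) ^ (n - i - j))" for v
  proof -
    let ?m = "\<lambda>i j. (v $ 1) ^ i * (v $ 2) ^ j * (v $ 3) ^ (n - i - j)"
    have pick: "(\<Sum>i\<le>n. \<Sum>j\<le>n - i. (if i = k \<and> j = l then 1 else 0) * ?m i j) = ?m k l"
      if "k + l \<le> n" for k l
    proof -
      have "(\<Sum>j\<le>n - i. (if i = k \<and> j = l then 1 else 0) * ?m i j)
          = (if i = k then ?m k l else 0)" if "i \<le> n" for i
      proof (cases "i = k")
        case True
        then have "(\<Sum>j\<le>n - i. (if i = k \<and> j = l then 1 else 0) * ?m i j)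
            = (\<Sum>j\<le>n - i. if j = l then ?m k l else 0)"
          by (intro sum.cong) auto
        then show ?thesis
          using True \<open>k + l \<le> n\<close> by simp
      qed simp
      then have "(\<Sum>i\<le>n. \<Sum>j\<le>n - i. (if i = k \<and> j = l then 1 else 0) * ?m i j)
          = (\<Sum>i\<le>n. if i = k then ?m k l else 0)"
        by (intro sum.cong) auto
      then show ?thesis
        using that by simp
    qed
    have "(\<Sum>i\<le>n. \<Sum>j\<le>n - i. a i j * (v $ 1) ^ i * (v $ 2) ^ j * (v $ 3) ^ (n - i - j))
        = ?m n 0 + ?m 0 n - ?m 0 0"
      unfolding a_def mult.assoc ring_distribs sum.distrib sum_subtractf
      using pick[of n 0] pick[of 0 n] pick[of 0 0]
      by (simp only: mult.assoc le_refl add_0 add_0_right zero_le simp_thms)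
    then show ?thesis
      by (simp add: fermat_form_eq)
  qed
  then show ?thesis
    unfolding ternary_form_def by blast
qed

lemma fermat_form_has_gradient: "has_gradient (fermat_form n) (of_nat n *s polar n v) v"
proof -
  have "has_gradient (fermat_form n)
      (\<Sum>i\<in>UNIV. v $ i ^ n *s 0 + fermat_sign i *s ((of_nat n * v $ i ^ (n - 1)) *s axis i 1)) v"
    unfolding fermat_form_def
    by (rule has_gradient_sum has_gradient_mult has_gradient_power has_gradient_component
        has_gradient_const)+
  moreover have "(\<Sum>i\<in>UNIV. v $ i ^ n *s 0 + fermat_sign i *s ((of_nat n * v $ i ^ (n - 1)) *s axis i 1))
      = of_nat n *s polar n v"
    by (simp add: vec_eq_iff polar_def axis_def if_distrib if_distribR mult_ac cong: if_cong)
  ultimately show ?thesis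
    by simp
qed

section \<open>Tangent lines of the Fermat curve\<close>

text \<open>The straight line \<open>v + t w\<close> leaves the cone only to second order, because \<open>F\<close> and its
  derivative in the direction \<open>w\<close> vanish at \<open>v\<close>. Changing a single nonzero coordinate, so that its
  \<open>n\<close>-th power absorbs the error \<open>F (v + t w)\<close>, puts it back on the cone; the required factor is an
  \<open>n\<close>-th root of a function with value \<open>1\<close> and derivative \<open>0\<close> at \<open>t = 0\<close>, so the velocity remains
  \<open>w\<close>.\<close>

lemma fermat_cone_curve:
  assumes n: "n > 0" and v: "v \<noteq> 0" "fermat_form n v = 0" and w: "pairing (polar n v) w = 0"
  obtains \<gamma> :: "complex \<Rightarrow> complex^3"
  where "\<gamma> 0 = v" "\<And>i. ((\<lambda>t. \<gamma> t $ i) has_field_derivative w $ i) (at 0)"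
    and "\<forall>\<^sub>F t in nhds 0. \<gamma> t \<noteq> 0 \<and> fermat_form n (\<gamma> t) = 0"
proof -
  obtain k where k: "v $ k \<noteq> 0"
    using v(1) by (auto simp: vec_eq_iff)
  define f where "f t = fermat_form n (v + t *s w)" for t
  define c where "c t = v $ k + t * w $ k" for t
  \<comment> \<open>the principal branch of the root is holomorphic near \<open>R 0 = 1\<close>\<close>
  define R where "R t = 1 - fermat_sign k * f t / c t ^ n" for t
  define h where "h t = exp (Ln (R t) / of_nat n)" for t
  define \<gamma> :: "complex \<Rightarrow> complex^3"
    where "\<gamma> t = (\<chi> i. if i = k then c t * h t else v $ i + t * w $ i)" for t
  have f0: "f 0 = 0"
    by (simp add: f_def v(2))
  have c0: "c 0 \<noteq> 0"
    using k by (simp add: c_def)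
  have line: "((\<lambda>t. (v + t *s w) $ i) has_field_derivative w $ i) (at 0)" for i
    by (auto intro!: derivative_eq_intros)
  have f': "(f has_field_derivative 0) (at 0)"
    using has_gradientD[of "fermat_form n" "of_nat n *s polar n v" "\<lambda>t. v + t *s w" w] line w
    by (simp add: f_def[abs_def] fermat_form_has_gradient pairing_smult_left)
  have c': "(c has_field_derivative w $ k) (at 0)"
    unfolding c_def by (auto intro!: derivative_eq_intros)
  have R0: "R 0 = 1"
    by (simp add: R_def f0)
  have R': "(R has_field_derivative 0) (at 0)"
    unfolding R_def using f' c' c0 f0 by (auto intro!: derivative_eq_intros)
  have h0: "h 0 = 1"
    by (simp add: h_def R0)
  have h': "(h has_field_derivative 0) (at 0)"
    unfolding h_def using R' R0 n by (auto intro!: derivative_eq_intros)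
  have g0: "\<gamma> 0 = v"
    by (simp add: \<gamma>_def vec_eq_iff h0 c_def)
  have g': "((\<lambda>t. \<gamma> t $ i) has_field_derivative w $ i) (at 0)" for i
  proof (cases "i = k")
    case True
    then show ?thesis
      using DERIV_mult[OF c' h'] by (simp add: \<gamma>_def h0)
  next
    case False
    then show ?thesis
      by (auto simp: \<gamma>_def intro!: derivative_eq_intros)
  qed
  have "\<forall>\<^sub>F t in nhds 0. c t \<noteq> 0 \<and> R t \<noteq> 0"
  proof (intro eventually_conj)
    have near: "\<forall>\<^sub>F t in nhds 0. q t \<noteq> 0"
      if "(q has_field_derivative D) (at 0)" "q 0 \<noteq> 0" for q :: "complex \<Rightarrow> complex" and D
    proof -
      have "(q \<longlongrightarrow> q 0) (nhds 0)"
        using DERIV_isCont[OF that(1)] by (simp add: continuous_at tendsto_nhds_iff)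
      then show ?thesis
        using tendsto_imp_eventually_ne that(2) by blast
    qed
    show "\<forall>\<^sub>F t in nhds 0. c t \<noteq> 0"
      by (rule near[OF c' c0])
    show "\<forall>\<^sub>F t in nhds 0. R t \<noteq> 0"
      by (rule near[OF R']) (simp add: R0)
  qed
  then have "\<forall>\<^sub>F t in nhds 0. \<gamma> t \<noteq> 0 \<and> fermat_form n (\<gamma> t) = 0"
  proof eventually_elim
    case (elim t)
    have gk: "\<gamma> t $ k = c t * h t"
      by (simp add: \<gamma>_def)
    then have "\<gamma> t $ k \<noteq> 0"
      using elim by (simp add: h_def)
    then have nonzero: "\<gamma> t \<noteq> 0"
      by auto
    have "h t ^ n = R t"
      using elim n by (simp add: h_def exp_of_nat_mult[symmetric])
    then have gkn: "\<gamma> t $ k ^ n = c t ^ n - fermat_sign k * f t"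
      using elim by (simp add: gk power_mult_distrib R_def field_simps)
    have "fermat_form n (\<gamma> t) = fermat_sign k * \<gamma> t $ k ^ n
        + (\<Sum>i\<in>UNIV - {k}. fermat_sign i * \<gamma> t $ i ^ n)"
      unfolding fermat_form_def by (rule sum.remove) auto
    also have "(\<Sum>i\<in>UNIV - {k}. fermat_sign i * \<gamma> t $ i ^ n)
        = (\<Sum>i\<in>UNIV - {k}. fermat_sign i * (v + t *s w) $ i ^ n)"
      by (intro sum.cong) (auto simp: \<gamma>_def)
    also have "\<dots> = f t - fermat_sign k * c t ^ n"
      unfolding f_def fermat_form_def by (subst sum.remove[of UNIV k]) (auto simp: c_def)
    finally have "fermat_form n (\<gamma> t) = f t - (fermat_sign k * fermat_sign k) * f t"
      by (simp only: gkn right_diff_distrib mult.assoc) simp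
    then show ?case
      using nonzero by simp
  qed
  with g0 g' show ?thesis
    by (rule that)
qed

text \<open>A form that vanishes on the curve is constant along every curve in the cone, so its
  gradient annihilates the velocities supplied by \<open>fermat_cone_curve\<close>.\<close>

lemma vanishing_form_gradient:
  assumes n: "n > 0" and v: "v \<noteq> 0" "fermat_form n v = 0" and w: "pairing (polar n v) w = 0"
    and G: "G \<in> vanishing_forms (fermat_curve n)"
  shows "pairing (gradient G v) w = 0"
proof -
  obtain \<gamma> where \<gamma>: "\<gamma> 0 = v" "\<And>i. ((\<lambda>t. \<gamma> t $ i) has_field_derivative w $ i) (at 0)"
    and cone: "\<forall>\<^sub>F t in nhds 0. \<gamma> t \<noteq> 0 \<and> fermat_form n (\<gamma> t) = 0"
    using fermat_cone_curve[OF n v w] by blast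
  obtain d where d: "ternary_form d G"
    and zero: "\<And>u. u \<noteq> 0 \<Longrightarrow> proj u \<in> fermat_curve n \<Longrightarrow> G u = 0"
    using G by (auto simp: vanishing_forms_def)
  have "((\<lambda>t. G (\<gamma> t)) has_field_derivative pairing (gradient G v) w) (at 0)"
    using has_gradientD[OF _ \<gamma>(2)] ternary_form_has_gradient[OF d] \<gamma>(1) by metis
  moreover have "((\<lambda>t. G (\<gamma> t)) has_field_derivative 0) (at 0)"
  proof -
    have "\<forall>\<^sub>F t in nhds 0. G (\<gamma> t) = 0"
      using cone by eventually_elim (simp add: zero proj_in_fermat_curve_iff)
    then show ?thesis
      using DERIV_cong_ev[of 0 0 "\<lambda>t. G (\<gamma> t)" "\<lambda>t. 0" 0 0] by simp
  qed
  ultimately show ?thesis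
    by (rule DERIV_unique)
qed

text \<open>The Fermat form is itself a vanishing form, which bounds the tangent space from above;
  \<open>vanishing_form_gradient\<close> shows that no other vanishing form makes it smaller.\<close>

lemma tangent_space_fermat_curve:
  assumes n: "n \<ge> 2" and v: "v \<noteq> 0" "fermat_form n v = 0"
  shows "tangent_space (fermat_curve n) (proj v) = line (proj (polar n v))"
proof -
  have "(\<forall>G\<in>vanishing_forms (fermat_curve n). \<forall>u. u \<noteq> 0 \<and> proj u = proj v \<longrightarrow>
      pairing (gradient G u) w = 0) \<longleftrightarrow> pairing (polar n v) w = 0" for w
  proof
    assume "\<forall>G\<in>vanishing_forms (fermat_curve n). \<forall>u. u \<noteq> 0 \<and> proj u = proj v \<longrightarrow>
      pairing (gradient G u) w = 0"
    moreover have "fermat_form n \<in> vanishing_forms (fermat_curve n)"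
      using fermat_form_ternary by (auto simp: vanishing_forms_def proj_in_fermat_curve_iff)
    ultimately have "pairing (gradient (fermat_form n) v) w = 0"
      using v(1) by blast
    then show "pairing (polar n v) w = 0"
      using n by (simp add: has_gradient_imp_gradient[OF fermat_form_has_gradient] pairing_smult_left)
  next
    assume w: "pairing (polar n v) w = 0"
    show "\<forall>G\<in>vanishing_forms (fermat_curve n). \<forall>u. u \<noteq> 0 \<and> proj u = proj v \<longrightarrow>
      pairing (gradient G u) w = 0"
    proof (intro ballI allI impI)
      fix G u assume G: "G \<in> vanishing_forms (fermat_curve n)" and u: "u \<noteq> 0 \<and> proj u = proj v"
      then obtain c where "u = c *s v"
        using v(1) proj_eq_iff by metis
      then have "fermat_form n u = 0" "pairing (polar n u) w = 0"
        using v(2) w by (simp_all add: fermat_form_smult polar_smult pairing_smult_left)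
      then show "pairing (gradient G u) w = 0"
        using vanishing_form_gradient[of n u w G] G u n by simp
    qed
  qed
  moreover have "line (proj (polar n v)) = {proj w | w. w \<noteq> 0 \<and> pairing (polar n v) w = 0}"
    using n v(1) by (simp add: line_proj polar_eq_0_iff)
  ultimately show ?thesis
    by (simp only: tangent_space_def)
qed

lemma tangent_lines_fermat_curve:
  assumes n: "n \<ge> 2"
  shows "{l. \<exists>p. smooth_point (fermat_curve n) p \<and> line l = tangent_space (fermat_curve n) p}
      = {proj (polar n v) | v. v \<noteq> 0 \<and> fermat_form n v = 0}"
proof (intro equalityI subsetI)
  fix l assume "l \<in> {l. \<exists>p. smooth_point (fermat_curve n) p \<and> line l = tangent_space (fermat_curve n) p}"
  then obtain p where p: "p \<in> fermat_curve n" "line l = tangent_space (fermat_curve n) p"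
    by (auto simp: smooth_point_def)
  obtain v where v: "v \<noteq> 0" "p = proj v" by (rule proj_surj)
  then have F: "fermat_form n v = 0"
    using p(1) by (simp add: proj_in_fermat_curve_iff)
  then have "l = proj (polar n v)"
    using p(2) v tangent_space_fermat_curve[OF n] line_inj by simp
  then show "l \<in> {proj (polar n v) | v. v \<noteq> 0 \<and> fermat_form n v = 0}"
    using v F by blast
next
  fix l assume "l \<in> {proj (polar n v) | v. v \<noteq> 0 \<and> fermat_form n v = 0}"
  then obtain v where v: "v \<noteq> 0" "fermat_form n v = 0" "l = proj (polar n v)"
    by auto
  have T: "tangent_space (fermat_curve n) (proj v) = line l"
    unfolding v(3) by (rule tangent_space_fermat_curve[OF n v(1,2)])
  moreover have "proj v \<in> fermat_curve n"
    using v by (simp add: proj_in_fermat_curve_iff)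
  ultimately have "smooth_point (fermat_curve n) (proj v)"
    unfolding smooth_point_def by blast
  then show "l \<in> {l. \<exists>p. smooth_point (fermat_curve n) p \<and> line l = tangent_space (fermat_curve n) p}"
    using T by (intro CollectI exI[of _ "proj v"]) simp
qed

section \<open>The set of tangent lines is closed\<close>

text \<open>Each component of \<open>polar n x\<close> has the modulus of a positive power of the component of \<open>x\<close>.
  Preimages of a convergent sequence are therefore bounded, and a limit point of them is a
  preimage of the limit.\<close>

lemma closed_polar_image:
  assumes n: "n \<ge> 2" and A: "closed A"
  shows "closed (polar n ` A)"
  unfolding closed_sequential_limits
proof (intro allI impI)
  fix y l assume "(\<forall>k. y k \<in> polar n ` A) \<and> y \<longlonglongrightarrow> l"
  then have y: "\<And>k. \<exists>x. x \<in> A \<and> y k = polar n x" and lim: "y \<longlonglongrightarrow> l"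
    by auto
  obtain x where x: "\<And>k. x k \<in> A" "\<And>k. y k = polar n (x k)"
    using y by metis
  obtain B where B: "\<And>k. norm (y k) \<le> B"
    using convergent_imp_bounded[OF lim] by (auto simp: bounded_iff)
  have "norm (x k $ i) \<le> max 1 B" for k i
  proof (cases "norm (x k $ i) \<le> 1")
    case False
    then have "norm (x k $ i) ^ 1 \<le> norm (x k $ i) ^ (n - 1)"
      using n by (intro power_increasing) auto
    also have "\<dots> = norm (y k $ i)"
      by (simp add: x(2) polar_def norm_mult norm_power fermat_sign_def)
    also have "\<dots> \<le> B"
      using Finite_Cartesian_Product.norm_nth_le B order_trans by blast
    finally show ?thesis by simp
  qed simp
  then have "norm (x k) \<le> (\<Sum>i\<in>(UNIV::3 set). max 1 B)" for k
    unfolding norm_vec_def by (intro order_trans[OF L2_set_le_sum] sum_mono) auto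
  then have "bounded (range x)"
    by (auto simp: bounded_iff)
  then obtain a r where r: "strict_mono r" "(x \<circ> r) \<longlonglongrightarrow> a"
    using bounded_imp_convergent_subsequence by blast
  have "a \<in> A"
    using closed_sequentially[OF A _ r(2)] x(1) by simp
  have "(\<lambda>k. x (r k)) \<longlonglongrightarrow> a"
    using r(2) by (simp add: o_def)
  then have "(\<lambda>k. polar n (x (r k))) \<longlonglongrightarrow> polar n a"
    unfolding polar_def by (intro vec_tendstoI) (auto intro!: tendsto_intros)
  moreover have "(\<lambda>k. polar n (x (r k))) = y \<circ> r"
    by (auto simp: x(2))
  ultimately have "polar n a = l"
    using LIMSEQ_subseq_LIMSEQ[OF lim r(1)] LIMSEQ_unique by metis
  then show "l \<in> polar n ` A"
    using \<open>a \<in> A\<close> by blast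
qed

text \<open>The image of the cone is invariant under scaling: the factor \<open>c\<close> is absorbed into the
  argument of the polar map as an \<open>(n - 1)\<close>-th root of \<open>c\<close>.\<close>

lemma cone_of_tangent_lines:
  assumes n: "n \<ge> 2" and rt: "root_branch (n - 1) rt" and l: "l \<noteq> 0"
  shows "proj l \<in> {proj (polar n v) | v. v \<noteq> 0 \<and> fermat_form n v = 0}
    \<longleftrightarrow> l \<in> polar n ` {v. fermat_form n v = 0}"
proof
  assume "proj l \<in> {proj (polar n v) | v. v \<noteq> 0 \<and> fermat_form n v = 0}"
  then obtain v where v: "v \<noteq> 0" "fermat_form n v = 0" "proj (polar n v) = proj l"
    by force
  then obtain c where "l = c *s polar n v"
    using l n by (auto simp: proj_eq_iff polar_eq_0_iff)
  then have "l = polar n (rt c *s v)"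
    using rt by (simp add: polar_smult root_branch_def)
  then show "l \<in> polar n ` {v. fermat_form n v = 0}"
    using v by (auto simp: fermat_form_smult)
next
  assume "l \<in> polar n ` {v. fermat_form n v = 0}"
  then show "proj l \<in> {proj (polar n v) | v. v \<noteq> 0 \<and> fermat_form n v = 0}"
    using l polar_eq_0_iff[OF n] by auto
qed

lemma closed_tangent_lines:
  assumes n: "n \<ge> 2" and rt: "root_branch (n - 1) rt"
  shows "closed {proj (polar n v) | v. v \<noteq> 0 \<and> fermat_form n v = 0}"
proof -
  define T where "T = {proj (polar n v) | v. v \<noteq> 0 \<and> fermat_form n v = 0}"
  define C where "C = polar n ` {v. fermat_form n v = 0}"
  have "closed {v. fermat_form n v = 0}"
    unfolding fermat_form_def by (intro closed_Collect_eq continuous_intros)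
  then have "open (- C)"
    using closed_polar_image[OF n] by (simp add: open_Compl C_def)
  moreover have "0 \<in> C"
    unfolding C_def using n polar_eq_0_iff[OF n, of 0]
    by (intro image_eqI[of _ _ 0]) (auto simp: fermat_form_eq)
  then have "l \<noteq> 0 \<and> proj l \<in> - T \<longleftrightarrow> l \<notin> C" for l
    using cone_of_tangent_lines[OF n rt, of l] unfolding T_def[symmetric] C_def[symmetric]
    by (cases "l = 0") simp_all
  then have "{l. l \<noteq> 0 \<and> proj l \<in> - T} = - C"
    by auto
  ultimately have "closed T"
    by (simp add: closed_def open_cp2_def)
  then show ?thesis
    by (simp add: T_def)
qed

section \<open>The equation of the dual curve\<close>

text \<open>The powers \<open>\<epsilon>\<^sup>1, \<dots>, \<epsilon>\<^sup>k\<close> are distinct, and there are only \<open>k\<close> roots of unity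
  of order dividing \<open>k\<close>.\<close>

lemma primitive_root_powers:
  assumes k: "k > 0" and \<epsilon>: "primitive_root_of_unity k \<epsilon>" and \<zeta>: "\<zeta> ^ k = 1"
  obtains r where "r \<in> {1..k}" "\<zeta> = \<epsilon> ^ r"
proof -
  have "\<epsilon> \<noteq> 0" "\<epsilon> ^ k = 1"
    using \<epsilon> k by (auto simp: primitive_root_of_unity_def power_0_left)
  have neq: "\<epsilon> ^ i \<noteq> \<epsilon> ^ j" if "i \<in> {1..k}" "j \<in> {1..k}" "i < j" for i j
  proof
    assume eq: "\<epsilon> ^ i = \<epsilon> ^ j"
    have "\<epsilon> ^ j = \<epsilon> ^ i * \<epsilon> ^ (j - i)"
      using that by (simp flip: power_add)
    then have "\<epsilon> ^ (j - i) = 1"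
      using \<open>\<epsilon> \<noteq> 0\<close> eq by simp
    moreover have "0 < j - i" "j - i < k"
      using that by auto
    ultimately show False
      using \<epsilon> by (auto simp: primitive_root_of_unity_def)
  qed
  have "inj_on (\<lambda>r. \<epsilon> ^ r) {1..k}"
    using neq by (intro linorder_inj_onI) auto
  then have "card ((\<lambda>r. \<epsilon> ^ r) ` {1..k}) = k"
    by (simp add: card_image)
  moreover have "(\<lambda>r. \<epsilon> ^ r) ` {1..k} \<subseteq> {z. z ^ k = 1}"
  proof clarify
    fix r
    have "(\<epsilon> ^ r) ^ k = (\<epsilon> ^ k) ^ r"
      by (simp flip: power_mult add: mult.commute)
    then show "(\<epsilon> ^ r) ^ k = 1"
      by (simp add: \<open>\<epsilon> ^ k = 1\<close>)
  qed
  ultimately have "(\<lambda>r. \<epsilon> ^ r) ` {1..k} = {z. z ^ k = 1}"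
    using k by (intro card_subset_eq) (auto simp: card_roots_unity_eq finite_roots_unity)
  then show ?thesis
    using \<zeta> that by blast
qed

text \<open>Any \<open>k\<close>-th root is a root of unity times the chosen one. Dividing a vanishing sum
  \<open>a + b + c\<close> by the root of unity that belongs to \<open>a\<close> turns it into one of the factors, in which
  the root of \<open>z\<close> carries no power of \<open>\<epsilon>\<close>.\<close>

lemma p_poly_eq_0_iff:
  assumes k: "k > 0" and \<epsilon>: "primitive_root_of_unity k \<epsilon>" and rt: "root_branch k rt"
  shows "p_poly k \<epsilon> rt z x y = 0 \<longleftrightarrow> (\<exists>a b c. a ^ k = z \<and> b ^ k = x \<and> c ^ k = y \<and> a + b + c = 0)"
proof -
  have rt: "rt u ^ k = u" for u
    using rt by (simp add: root_branch_def)
  have "\<exists>a b c. a ^ k = z \<and> b ^ k = x \<and> c ^ k = y \<and> a + b + c = 0"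
    if zero: "p_poly k \<epsilon> rt z x y = 0"
  proof -
    obtain r s where "rt z + \<epsilon> ^ r * rt x + \<epsilon> ^ s * rt y = 0"
      using zero by (auto simp: p_poly_def)
    moreover have "(\<epsilon> ^ r) ^ k = 1" for r
      using \<epsilon> by (metis mult.commute power_mult power_one primitive_root_of_unity_def)
    ultimately show ?thesis
      by (metis rt power_mult_distrib mult_1)
  qed
  moreover have "p_poly k \<epsilon> rt z x y = 0"
    if abc: "a ^ k = z" "b ^ k = x" "c ^ k = y" "a + b + c = 0" for a b c
  proof -
    have ratio: "\<exists>\<zeta>. \<zeta> ^ k = 1 \<and> d = \<zeta> * rt u" if "d ^ k = u" for d u
    proof (cases "u = 0")
      case True
      then show ?thesis
        using that k rt[of 0] by (intro exI[of _ 1]) simp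
    next
      case False
      then have "rt u \<noteq> 0"
        using rt[of u] k by (auto simp: power_0_left)
      then show ?thesis
        using that False rt[of u] by (intro exI[of _ "d / rt u"]) (simp add: power_divide)
    qed
    obtain \<alpha> where \<alpha>: "\<alpha> ^ k = 1" "a = \<alpha> * rt z" using ratio[OF abc(1)] by blast
    obtain \<beta> where \<beta>: "\<beta> ^ k = 1" "b = \<beta> * rt x" using ratio[OF abc(2)] by blast
    obtain \<delta> where \<delta>: "\<delta> ^ k = 1" "c = \<delta> * rt y" using ratio[OF abc(3)] by blast
    have "\<alpha> \<noteq> 0"
      using \<alpha>(1) k by (auto simp: power_0_left)
    obtain r where r: "r \<in> {1..k}" "\<beta> / \<alpha> = \<epsilon> ^ r"
      using primitive_root_powers[OF k \<epsilon>, of "\<beta> / \<alpha>"] \<alpha> \<beta> by (auto simp: power_divide)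
    obtain s where s: "s \<in> {1..k}" "\<delta> / \<alpha> = \<epsilon> ^ s"
      using primitive_root_powers[OF k \<epsilon>, of "\<delta> / \<alpha>"] \<alpha> \<delta> by (auto simp: power_divide)
    have "rt z + \<epsilon> ^ r * rt x + \<epsilon> ^ s * rt y = (a + b + c) / \<alpha>"
      using \<open>\<alpha> \<noteq> 0\<close> by (simp add: r(2)[symmetric] s(2)[symmetric] \<alpha>(2) \<beta>(2) \<delta>(2) field_simps)
    then have "rt z + \<epsilon> ^ r * rt x + \<epsilon> ^ s * rt y = 0"
      using abc(4) by simp
    then show ?thesis
      unfolding p_poly_def using r(1) s(1) by (intro prod_zero bexI[of _ r] bexI[of _ s]) auto
  qed
  ultimately show ?thesis
    by blast
qed

text \<open>The quotient of \<open>x ^ Suc m\<close> by \<open>x ^ m\<close> forces \<open>x = b / u\<close> when \<open>u\<close> is nonzero.\<close>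

lemma common_root:
  fixes u b :: complex
  assumes "m > 0" "b ^ m = u ^ Suc m"
  obtains x where "x ^ m = u" "x ^ Suc m = b"
proof (cases "u = 0")
  case True
  then show ?thesis
    using assms that[of 0] by (simp add: power_0_left)
next
  case False
  have "(b / u) ^ m = u"
    using False assms(2) by (simp add: power_divide)
  then show ?thesis
    using False that[of "b / u"] by simp
qed

lemma fermat_dual_eq_0_iff:
  assumes n: "n \<ge> 2" and \<epsilon>: "primitive_root_of_unity (n - 1) \<epsilon>" and rt: "root_branch (n - 1) rt"
  shows "fermat_dual n \<epsilon> rt (l $ 1) (l $ 2) (l $ 3) = 0 \<longleftrightarrow> l \<in> polar n ` {v. fermat_form n v = 0}"
proof -
  obtain m where m: "n = Suc m" "m > 0"
    using n by (cases n) auto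
  \<comment> \<open>the exponents \<open>m\<close> and \<open>n\<close> have opposite parity\<close>
  have neg: "(- t) ^ m = - (w ^ n) \<longleftrightarrow> t ^ m = (- w) ^ n" for t w :: complex
    unfolding m(1) by (cases "even m") (auto simp: minus_equation_iff)
  have "fermat_dual n \<epsilon> rt (l $ 1) (l $ 2) (l $ 3) = 0
      \<longleftrightarrow> (\<exists>a b c. a ^ m = - (l $ 3 ^ n) \<and> b ^ m = l $ 1 ^ n \<and> c ^ m = l $ 2 ^ n \<and> a + b + c = 0)"
    using p_poly_eq_0_iff[of m \<epsilon> rt] m \<epsilon> rt by (simp add: fermat_dual_def)
  also have "\<dots> \<longleftrightarrow> l \<in> polar n ` {v. fermat_form n v = 0}"
  proof
    assume "\<exists>a b c. a ^ m = - (l $ 3 ^ n) \<and> b ^ m = l $ 1 ^ n \<and> c ^ m = l $ 2 ^ n \<and> a + b + c = 0"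
    then obtain a b c where abc: "a ^ m = - (l $ 3 ^ n)" "b ^ m = l $ 1 ^ n" "c ^ m = l $ 2 ^ n"
        "a + b + c = 0"
      by blast
    obtain x where x: "x ^ m = l $ 1" "x ^ n = b"
      using common_root[OF m(2)] abc(2) m(1) by metis
    obtain y where y: "y ^ m = l $ 2" "y ^ n = c"
      using common_root[OF m(2)] abc(3) m(1) by metis
    have "(- a) ^ m = (- (l $ 3)) ^ n"
      using neg[of "- a" "l $ 3"] abc(1) by simp
    then obtain z where z: "z ^ m = - (l $ 3)" "z ^ n = - a"
      using common_root[OF m(2)] m(1) by metis
    have "l = polar n (vector [x, y, z])"
      using x y z by (simp add: m(1) polar_def vec_eq_iff forall_3 fermat_sign_simps)
    moreover have "fermat_form n (vector [x, y, z]) = 0"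
      using x y z abc(4) by (simp add: fermat_form_eq add_ac)
    ultimately show "l \<in> polar n ` {v. fermat_form n v = 0}"
      by blast
  next
    assume "l \<in> polar n ` {v. fermat_form n v = 0}"
    then obtain v where v: "l = polar n v" "fermat_form n v = 0"
      by blast
    have l: "l $ 1 = v $ 1 ^ m" "l $ 2 = v $ 2 ^ m" "l $ 3 = - (v $ 3 ^ m)"
      by (simp_all add: v(1) m(1) polar_def fermat_sign_simps)
    have swap: "(t ^ n) ^ m = (t ^ m) ^ n" for t :: complex
      by (simp flip: power_mult add: mult.commute)
    show "\<exists>a b c. a ^ m = - (l $ 3 ^ n) \<and> b ^ m = l $ 1 ^ n \<and> c ^ m = l $ 2 ^ n \<and> a + b + c = 0"
    proof (rule exI[of _ "- (v $ 3 ^ n)"], rule exI[of _ "v $ 1 ^ n"], rule exI[of _ "v $ 2 ^ n"],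
        intro conjI)
      show "(- (v $ 3 ^ n)) ^ m = - (l $ 3 ^ n)"
        unfolding neg by (simp add: l swap)
      show "(v $ 1 ^ n) ^ m = l $ 1 ^ n" "(v $ 2 ^ n) ^ m = l $ 2 ^ n"
        by (simp_all add: l swap)
      show "- (v $ 3 ^ n) + v $ 1 ^ n + v $ 2 ^ n = 0"
        using v(2) by (simp add: fermat_form_eq algebra_simps)
    qed
  qed
  finally show ?thesis .
qed

theorem theorem8:
  fixes n :: nat and \<epsilon> :: complex and rt :: "complex \<Rightarrow> complex"
  assumes "n \<ge> 2"
    and "primitive_root_of_unity (n - 1) \<epsilon>"
    and "root_branch (n - 1) rt"
  shows "dual_curve (fermat_curve n) =
    {pt u v w | u v w. (u, v, w) \<noteq> (0, 0, 0) \<and> fermat_dual n \<epsilon> rt u v w = 0}"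
proof -
  define T where "T = {proj (polar n v) | v. v \<noteq> 0 \<and> fermat_form n v = 0}"
  have "dual_curve (fermat_curve n) = T"
    unfolding dual_curve_def tangent_lines_fermat_curve[OF assms(1)] T_def
    by (rule closure_closed[OF closed_tangent_lines[OF assms(1,3)]])
  also have "T = {proj l | l. l \<noteq> 0 \<and> proj l \<in> T}"
    by (auto intro: proj_surj)
  also have "\<dots> = {proj l | l. l \<noteq> 0 \<and> fermat_dual n \<epsilon> rt (l $ 1) (l $ 2) (l $ 3) = 0}"
  proof -
    have "proj l \<in> T \<longleftrightarrow> fermat_dual n \<epsilon> rt (l $ 1) (l $ 2) (l $ 3) = 0" if "l \<noteq> 0" for l
      unfolding T_def cone_of_tangent_lines[OF assms(1,3) that] fermat_dual_eq_0_iff[OF assms] ..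
    then show ?thesis
      by metis
  qed
  also have "\<dots> = {pt u v w | u v w. (u, v, w) \<noteq> (0, 0, 0) \<and> fermat_dual n \<epsilon> rt u v w = 0}"
    by (rule pts_eq_projs[symmetric])
  finally show ?thesis .
qed

end
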